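(* Let $K/F$ be a finite field extension, let $\sigma\in \mathrm{Aut}_F(K)$ with $\sigma\neq\mathrm{id}$, and let $c\in K^{\times}$. If $c$ is a square in $K$, then $D(K,\sigma,c)$ is not a division algebra.
   Context: $D(K,\sigma,c)$ denotes the $F$-vector space $K\oplus K$ with multiplication $(u,v)(x,y)=(ux+c\,\sigma(vy),\,uy+vx)$ for $u,v,x,y\in K$; it is a unital commutative, not necessarily associative, finite-dimensional $F$-algebra. A finite-dimensional (nonassociative) $F$-algebra $A$ is a division algebra if for every nonzero $a\in A$ the maps $x\mapsto ax$ and $x\mapsto xa$ are bijective; equivalently, $A$ has no zero divisors. The field $F$ is arbitrary. *)

theory Defs
  imports "HOL-Algebra.Algebra"
begin

text \<open>
  A field extension \<open>K/F\<close> is a field \<open>K\<close> with a subfield \<open>F\<close> of it;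
  \<open>K\<lparr>carrier := F\<rparr>\<close> is then \<open>F\<close> as a field in its own right.
  An automorphism is only determined on \<open>carrier K\<close>: values outside the carrier are irrelevant.
\<close>

definition field_aut :: "'a set \<Rightarrow> ('a, 'm) ring_scheme \<Rightarrow> ('a \<Rightarrow> 'a) set"
  where "field_aut F K = {\<sigma> \<in> ring_iso K K. \<forall>a\<in>F. \<sigma> a = a}"

text \<open>
  The library locale \<^locale>\<open>algebra\<close> assumes an associative and commutative
  multiplication. Here the multiplication is merely bilinear and no unit is required
  (the \<open>one\<close> field of the record is unconstrained).
\<close>

locale nonassoc_algebra = F?: field F + module F A
  for F :: "('a, 'm) ring_scheme" (structure) and A :: "('a, 'b, 'n) module_scheme" (structure) +
  assumes mult_closed:
      "\<lbrakk>x \<in> carrier A; y \<in> carrier A\<rbrakk> \<Longrightarrow> x \<otimes>\<^bsub>A\<^esub> y \<in> carrier A"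
    and mult_l_distr:
      "\<lbrakk>x \<in> carrier A; y \<in> carrier A; z \<in> carrier A\<rbrakk> \<Longrightarrow>
        (x \<oplus>\<^bsub>A\<^esub> y) \<otimes>\<^bsub>A\<^esub> z = x \<otimes>\<^bsub>A\<^esub> z \<oplus>\<^bsub>A\<^esub> y \<otimes>\<^bsub>A\<^esub> z"
    and mult_r_distr:
      "\<lbrakk>x \<in> carrier A; y \<in> carrier A; z \<in> carrier A\<rbrakk> \<Longrightarrow>
        x \<otimes>\<^bsub>A\<^esub> (y \<oplus>\<^bsub>A\<^esub> z) = x \<otimes>\<^bsub>A\<^esub> y \<oplus>\<^bsub>A\<^esub> x \<otimes>\<^bsub>A\<^esub> z"
    and smult_mult_l:
      "\<lbrakk>a \<in> carrier F; x \<in> carrier A; y \<in> carrier A\<rbrakk> \<Longrightarrow>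
        (a \<odot>\<^bsub>A\<^esub> x) \<otimes>\<^bsub>A\<^esub> y = a \<odot>\<^bsub>A\<^esub> (x \<otimes>\<^bsub>A\<^esub> y)"
    and smult_mult_r:
      "\<lbrakk>a \<in> carrier F; x \<in> carrier A; y \<in> carrier A\<rbrakk> \<Longrightarrow>
        x \<otimes>\<^bsub>A\<^esub> (a \<odot>\<^bsub>A\<^esub> y) = a \<odot>\<^bsub>A\<^esub> (x \<otimes>\<^bsub>A\<^esub> y)"

text \<open>Finite dimension: some finite set lies in no proper subspace, i.e. it spans the space.\<close>

locale fin_dim_nonassoc_algebra = nonassoc_algebra +
  assumes finitely_spanned:
    "\<exists>B. finite B \<and> B \<subseteq> carrier A \<and> (\<forall>S. submodule S F A \<and> B \<subseteq> S \<longrightarrow> S = carrier A)"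

text \<open>
  To be applied to finite-dimensional nonassociative algebras. The condition does not mention
  the scalars, and it does not repeat the algebra axioms, so that its negation really says that
  some multiplication by a nonzero element fails to be bijective.
\<close>

definition division_algebra :: "('a, 'b, 'n) module_scheme \<Rightarrow> bool"
  where "division_algebra A \<longleftrightarrow>
    (\<forall>a \<in> carrier A - {\<zero>\<^bsub>A\<^esub>}.
       bij_betw (\<lambda>x. a \<otimes>\<^bsub>A\<^esub> x) (carrier A) (carrier A) \<and>
       bij_betw (\<lambda>x. x \<otimes>\<^bsub>A\<^esub> a) (carrier A) (carrier A))"

text \<open>
  The algebra \<open>D(K, \<sigma>, c)\<close>. Scalar multiplication is written for all of \<open>K\<close>,
  but only scalars fixed by \<open>\<sigma>\<close> make the multiplication bilinear.
\<close>

definition D_alg ::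
    "('a, 'm) ring_scheme \<Rightarrow> ('a \<Rightarrow> 'a) \<Rightarrow> 'a \<Rightarrow> ('a, 'a \<times> 'a) module"
  where "D_alg K \<sigma> c =
    \<lparr>carrier = carrier K \<times> carrier K,
     monoid.mult = (\<lambda>(u, v) (x, y).
       ((u \<otimes>\<^bsub>K\<^esub> x) \<oplus>\<^bsub>K\<^esub> (c \<otimes>\<^bsub>K\<^esub> \<sigma> (v \<otimes>\<^bsub>K\<^esub> y)),
        (u \<otimes>\<^bsub>K\<^esub> y) \<oplus>\<^bsub>K\<^esub> (v \<otimes>\<^bsub>K\<^esub> x))),
     monoid.one = (\<one>\<^bsub>K\<^esub>, \<zero>\<^bsub>K\<^esub>),
     ring.zero = (\<zero>\<^bsub>K\<^esub>, \<zero>\<^bsub>K\<^esub>),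
     ring.add = (\<lambda>(u, v) (x, y). (u \<oplus>\<^bsub>K\<^esub> x, v \<oplus>\<^bsub>K\<^esub> y)),
     module.smult = (\<lambda>a (u, v). (a \<otimes>\<^bsub>K\<^esub> u, a \<otimes>\<^bsub>K\<^esub> v))\<rparr>"

lemma D_alg_simps [simp]:
  "carrier (D_alg K \<sigma> c) = carrier K \<times> carrier K"
  "(u, v) \<otimes>\<^bsub>D_alg K \<sigma> c\<^esub> (x, y) =
     ((u \<otimes>\<^bsub>K\<^esub> x) \<oplus>\<^bsub>K\<^esub> (c \<otimes>\<^bsub>K\<^esub> \<sigma> (v \<otimes>\<^bsub>K\<^esub> y)),
      (u \<otimes>\<^bsub>K\<^esub> y) \<oplus>\<^bsub>K\<^esub> (v \<otimes>\<^bsub>K\<^esub> x))"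
  "\<one>\<^bsub>D_alg K \<sigma> c\<^esub> = (\<one>\<^bsub>K\<^esub>, \<zero>\<^bsub>K\<^esub>)"
  "\<zero>\<^bsub>D_alg K \<sigma> c\<^esub> = (\<zero>\<^bsub>K\<^esub>, \<zero>\<^bsub>K\<^esub>)"
  "(u, v) \<oplus>\<^bsub>D_alg K \<sigma> c\<^esub> (x, y) = (u \<oplus>\<^bsub>K\<^esub> x, v \<oplus>\<^bsub>K\<^esub> y)"
  "a \<odot>\<^bsub>D_alg K \<sigma> c\<^esub> (u, v) = (a \<otimes>\<^bsub>K\<^esub> u, a \<otimes>\<^bsub>K\<^esub> v)"
  by (simp_all add: D_alg_def)

lemma D_alg_comm_unital:
  assumes "field K" "\<sigma> \<in> field_aut F K" "c \<in> carrier K"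
    and "p \<in> carrier (D_alg K \<sigma> c)" "q \<in> carrier (D_alg K \<sigma> c)"
  shows "p \<otimes>\<^bsub>D_alg K \<sigma> c\<^esub> q = q \<otimes>\<^bsub>D_alg K \<sigma> c\<^esub> p"
    and "\<one>\<^bsub>D_alg K \<sigma> c\<^esub> \<otimes>\<^bsub>D_alg K \<sigma> c\<^esub> p = p"
proof -
  interpret field K by fact
  have "\<sigma> \<in> ring_hom K K" using assms(2) by (auto simp: field_aut_def ring_iso_def)
  then interpret s: ring_hom_ring K K \<sigma>
    by (intro ring_hom_ringI2 is_ring)
  show "p \<otimes>\<^bsub>D_alg K \<sigma> c\<^esub> q = q \<otimes>\<^bsub>D_alg K \<sigma> c\<^esub> p"
    using assms by (cases p; cases q) (auto simp: m_comm a_comm)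
  show "\<one>\<^bsub>D_alg K \<sigma> c\<^esub> \<otimes>\<^bsub>D_alg K \<sigma> c\<^esub> p = p"
    using assms by (cases p) auto
qed

lemma D_alg_fin_dim_nonassoc_algebra:
  assumes K: "field K" and F: "subfield F K"
    and fin: "ring.finite_dimension K F (carrier K)"
    and sigma: "\<sigma> \<in> field_aut F K" and c: "c \<in> carrier K"
  shows "fin_dim_nonassoc_algebra (K\<lparr>carrier := F\<rparr>) (D_alg K \<sigma> c)"
proof -
  interpret field K by fact
  interpret FF: field "K\<lparr>carrier := F\<rparr>" using subfield_iff(2)[OF F] .
  have hom: "\<sigma> \<in> ring_hom K K" and fixF: "\<And>a. a \<in> F \<Longrightarrow> \<sigma> a = a"
    using sigma by (auto simp: field_aut_def ring_iso_def)
  interpret s: ring_hom_ring K K \<sigma>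
    using hom by (intro ring_hom_ringI2 is_ring)
  let ?F = "K\<lparr>carrier := F\<rparr>" and ?D = "D_alg K \<sigma> c"
  have FK: "\<And>a. a \<in> F \<Longrightarrow> a \<in> carrier K"
    using subfieldE(3)[OF F] by auto
  have ab: "abelian_group ?D"
  proof (rule abelian_groupI)
    fix x assume "x \<in> carrier ?D"
    then show "\<exists>y\<in>carrier ?D. y \<oplus>\<^bsub>?D\<^esub> x = \<zero>\<^bsub>?D\<^esub>"
      by (intro bexI[of _ "(\<ominus>\<^bsub>K\<^esub> fst x, \<ominus>\<^bsub>K\<^esub> snd x)"]) (auto simp: l_neg)
  qed (auto simp: a_ac)
  have mod: "module ?F ?D"
    by (rule moduleI[OF FF.is_cring ab]) (auto simp: FK l_distr r_distr m_assoc)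
  interpret M: module ?F ?D by (rule mod)
  have sm: "\<sigma> (a \<otimes>\<^bsub>K\<^esub> v) = a \<otimes>\<^bsub>K\<^esub> \<sigma> v" if "a \<in> F" "v \<in> carrier K" for a v
    using that by (simp add: FK fixF)
  have na: "nonassoc_algebra ?F ?D"
  proof (intro nonassoc_algebra.intro FF.field_axioms mod nonassoc_algebra_axioms.intro)
    fix x y z assume "x \<in> carrier ?D" "y \<in> carrier ?D" "z \<in> carrier ?D"
    then show "(x \<oplus>\<^bsub>?D\<^esub> y) \<otimes>\<^bsub>?D\<^esub> z = x \<otimes>\<^bsub>?D\<^esub> z \<oplus>\<^bsub>?D\<^esub> y \<otimes>\<^bsub>?D\<^esub> z"
      and "x \<otimes>\<^bsub>?D\<^esub> (y \<oplus>\<^bsub>?D\<^esub> z) = x \<otimes>\<^bsub>?D\<^esub> y \<oplus>\<^bsub>?D\<^esub> x \<otimes>\<^bsub>?D\<^esub> z"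
      using c by (auto simp: l_distr r_distr a_ac)
  next
    fix a x y assume "a \<in> carrier ?F" "x \<in> carrier ?D" "y \<in> carrier ?D"
    then show "(a \<odot>\<^bsub>?D\<^esub> x) \<otimes>\<^bsub>?D\<^esub> y = a \<odot>\<^bsub>?D\<^esub> (x \<otimes>\<^bsub>?D\<^esub> y)"
      and "x \<otimes>\<^bsub>?D\<^esub> (a \<odot>\<^bsub>?D\<^esub> y) = a \<odot>\<^bsub>?D\<^esub> (x \<otimes>\<^bsub>?D\<^esub> y)"
      using c by (auto simp: FK fixF m_ac r_distr)
  qed (use c in auto)
  obtain n where "dimension n F (carrier K)" using fin by auto
  then obtain Us where Us: "set Us \<subseteq> carrier K" "Span F Us = carrier K"
    using exists_base[OF F] by blast
  define B where "B = (\<lambda>u. (u, \<zero>\<^bsub>K\<^esub>)) ` set Us \<union> (\<lambda>u. (\<zero>\<^bsub>K\<^esub>, u)) ` set Us"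
  have "S = carrier ?D" if S: "submodule S ?F ?D" and BS: "B \<subseteq> S" for S
  proof
    note SE = M.submoduleE[OF S]
    show "S \<subseteq> carrier ?D" using SE(1) .
    obtain s where "s \<in> S" using SE(2) by blast
    then have "\<zero>\<^bsub>K\<lparr>carrier := F\<rparr>\<^esub> \<odot>\<^bsub>?D\<^esub> s \<in> S" using SE(4) FF.zero_closed by blast
    then have zero: "(\<zero>\<^bsub>K\<^esub>, \<zero>\<^bsub>K\<^esub>) \<in> S"
      using \<open>s \<in> S\<close> SE(1) by (cases s) auto
    have add: "(a \<oplus>\<^bsub>K\<^esub> x, b \<oplus>\<^bsub>K\<^esub> y) \<in> S" if "(a, b) \<in> S" "(x, y) \<in> S" for a b x y
      using SE(5)[OF that] by simp
    have smul: "(k \<otimes>\<^bsub>K\<^esub> x, k \<otimes>\<^bsub>K\<^esub> y) \<in> S" if "k \<in> F" "(x, y) \<in> S" for k x y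
      using SE(4)[of k "(x, y)"] that by simp
    have span: "(x, \<zero>\<^bsub>K\<^esub>) \<in> S \<and> (\<zero>\<^bsub>K\<^esub>, x) \<in> S"
      if "set Vs \<subseteq> set Us" "x \<in> Span F Vs" for Vs x
      using that
    proof (induction Vs arbitrary: x)
      case Nil
      then show ?case using zero by simp
    next
      case (Cons u Vs)
      then obtain k w where kw: "k \<in> F" "w \<in> Span F Vs" "x = (k \<otimes>\<^bsub>K\<^esub> u) \<oplus>\<^bsub>K\<^esub> w"
        by (auto simp: line_extension_mem_iff)
      have uS: "(u, \<zero>\<^bsub>K\<^esub>) \<in> S" "(\<zero>\<^bsub>K\<^esub>, u) \<in> S"
        using Cons.prems BS by (auto simp: B_def)
      have wS: "(w, \<zero>\<^bsub>K\<^esub>) \<in> S" "(\<zero>\<^bsub>K\<^esub>, w) \<in> S"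
        using Cons.IH[OF _ kw(2)] Cons.prems by auto
      show ?case
        using add[OF smul[OF kw(1) uS(1)] wS(1)] add[OF smul[OF kw(1) uS(2)] wS(2)] FK[OF kw(1)]
        by (simp add: kw(3))
    qed
    show "carrier ?D \<subseteq> S"
    proof
      fix p assume "p \<in> carrier ?D"
      then obtain x y where p: "p = (x, y)" "x \<in> carrier K" "y \<in> carrier K" by auto
      then have "(x, \<zero>\<^bsub>K\<^esub>) \<in> S" "(\<zero>\<^bsub>K\<^esub>, y) \<in> S"
        using span[of Us] Us(2) by auto
      from add[OF this] show "p \<in> S" using p by simp
    qed
  qed
  moreover have "finite B" "B \<subseteq> carrier ?D" using Us(1) by (auto simp: B_def)
  ultimately show ?thesis
    by (intro fin_dim_nonassoc_algebra.intro na fin_dim_nonassoc_algebra_axioms.intro) blast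
qed

end

theory Submission
  imports Defs
begin

text \<open>The elements \<open>(1, t)\<close> and \<open>(1, -t)\<close> are conjugates: the second
  coordinate of their product cancels, and the first is
  \<open>1 - c \<sigma>(t\<^sup>2) = 1 - (d \<sigma>(t))\<^sup>2\<close> by multiplicativity of
  \<open>\<sigma>\<close>. As \<open>\<sigma>\<close> is onto, some \<open>t\<close> makes this
  vanish, giving zero divisors.\<close>

text \<open>
  If \<open>c = d\<^sup>2\<close> and \<open>\<sigma> t = 1/d\<close>, then \<open>(1, t) (1, -t) = (1 - c \<sigma>(t\<^sup>2), 0) = (0, 0)\<close>.
\<close>

theorem corollary2p5:
  fixes K :: "('a, 'm) ring_scheme" and F :: "'a set" and \<sigma> :: "'a \<Rightarrow> 'a" and c :: 'a
  assumes "field K" and "subfield F K"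
    and "ring.finite_dimension K F (carrier K)"
    and "\<sigma> \<in> field_aut F K"
    and "\<exists>x\<in>carrier K. \<sigma> x \<noteq> x"
    and "c \<in> carrier K - {\<zero>\<^bsub>K\<^esub>}"
    and "\<exists>d\<in>carrier K. c = d [^]\<^bsub>K\<^esub> (2::nat)"
  shows "\<not> division_algebra (D_alg K \<sigma> c)"
proof -
  interpret field K by fact
  have iso: "\<sigma> \<in> ring_iso K K"
    using assms(4) by (simp add: field_aut_def)
  then interpret s: ring_hom_ring K K \<sigma>
    by (intro ring_hom_ringI2 is_ring) (simp add: ring_iso_def)
  let ?D = "D_alg K \<sigma> c"
  have c: "c \<in> carrier K" "c \<noteq> \<zero>\<^bsub>K\<^esub>" using assms(6) by auto
  obtain d where d: "d \<in> carrier K" "c = d \<otimes>\<^bsub>K\<^esub> d"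
    using assms(7) by (auto simp: numeral_2_eq_2)
  \<comment> \<open>Since \<open>c\<close> is nonzero, so is its square root
    \<open>d\<close>.\<close>
  with c have "d \<in> Units K" by (auto simp: field_Units)
  then have e: "inv\<^bsub>K\<^esub> d \<in> carrier K" "d \<otimes>\<^bsub>K\<^esub> inv\<^bsub>K\<^esub> d = \<one>\<^bsub>K\<^esub>" by auto
  have "\<sigma> ` carrier K = carrier K"
    using iso by (simp add: ring_iso_def bij_betw_def)
  with e(1) obtain t where t: "t \<in> carrier K" "\<sigma> t = inv\<^bsub>K\<^esub> d"
    by (metis imageE)
  have "c \<otimes>\<^bsub>K\<^esub> \<sigma> (t \<otimes>\<^bsub>K\<^esub> t) = (d \<otimes>\<^bsub>K\<^esub> inv\<^bsub>K\<^esub> d) \<otimes>\<^bsub>K\<^esub> (d \<otimes>\<^bsub>K\<^esub> inv\<^bsub>K\<^esub> d)"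
    using d e(1) t by (simp add: m_ac)
  then have ct: "c \<otimes>\<^bsub>K\<^esub> \<sigma> (t \<otimes>\<^bsub>K\<^esub> t) = \<one>\<^bsub>K\<^esub>" by (simp add: e(2))
  \<comment> \<open>Removing \<open>s.hom_mult\<close> keeps \<open>\<sigma>\<close> of the product
    \<open>t t\<close> unsplit, so that \<open>ct\<close> can rewrite it.\<close>
  have "(\<one>\<^bsub>K\<^esub>, t) \<otimes>\<^bsub>?D\<^esub> (\<one>\<^bsub>K\<^esub>, \<ominus>\<^bsub>K\<^esub> t) = (\<zero>\<^bsub>K\<^esub>, \<zero>\<^bsub>K\<^esub>)"
    using t(1) c(1) ct by (simp add: r_minus r_neg l_neg del: s.hom_mult)
  moreover have "(\<one>\<^bsub>K\<^esub>, t) \<otimes>\<^bsub>?D\<^esub> (\<zero>\<^bsub>K\<^esub>, \<zero>\<^bsub>K\<^esub>) = (\<zero>\<^bsub>K\<^esub>, \<zero>\<^bsub>K\<^esub>)"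
    using t(1) c(1) by simp
  \<comment> \<open>The first coordinate 1 separates the two arguments in every characteristic, even
    when \<open>t = -t\<close>; left multiplication by \<open>(1, t)\<close> sends both to
    zero.\<close>
  moreover have "(\<one>\<^bsub>K\<^esub>, \<ominus>\<^bsub>K\<^esub> t) \<in> carrier ?D" "(\<zero>\<^bsub>K\<^esub>, \<zero>\<^bsub>K\<^esub>) \<in> carrier ?D"
    "(\<one>\<^bsub>K\<^esub>, \<ominus>\<^bsub>K\<^esub> t) \<noteq> (\<zero>\<^bsub>K\<^esub>, \<zero>\<^bsub>K\<^esub>)"
    using t(1) by simp_all
  ultimately have "\<not> inj_on (\<lambda>x. (\<one>\<^bsub>K\<^esub>, t) \<otimes>\<^bsub>?D\<^esub> x) (carrier ?D)"
    unfolding inj_on_def by metis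
  moreover have "(\<one>\<^bsub>K\<^esub>, t) \<in> carrier ?D - {\<zero>\<^bsub>?D\<^esub>}"
    using t(1) by simp
  ultimately show ?thesis
    unfolding division_algebra_def bij_betw_def by blast
qed

end
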